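(* Let $0<q\le\infty$ and $1<p<\infty$. Let $b_0,b_1,b_2,c_0,c_1,c_2\in\mathbb{R}$, let $k\ge1$ be an integer, and let $$Ff(y)=y^{c_0}\int_0^\infty x^{b_0}f(x)K(x,y)\,dx,\qquad K(x,y)=x^{b_1}y^{c_1}\sum_{m=0}^\infty a_m(xy)^{km},\qquad x,y>0,$$ where $a_m\in\mathbb{C}$, $|a_0|>0$, $\sum_{m=0}^\infty|a_m|<\infty$, and the series defining $K$ converges for all $x,y>0$. Assume there is $C>0$ such that $|K(x,y)|\le Cx^{b_1}y^{c_1}$ if $xy\le1$ and $|K(x,y)|\le Cx^{b_2}y^{c_2}$ if $xy>1$. Suppose furthermore that there exist $\nu\in\mathbb{R}$ and, for each $y>0$, a function $G_y^\nu(x)$ of $x>0$ with $\frac{d}{dx}G_y^\nu(x)=x^\nu K(x,y)$, and that there exist $C'>0$ and $b,c\in\mathbb{R}$ with $b-b_1-\nu<1$ such that $$|G_y^\nu(x)|\le C'x^by^c,\qquad xy\ge1.$$ Let $u$ be a weight that is not identically zero (i.e. not zero almost everywhere). Then the weighted norm inequality $$\bigg(\int_0^\infty u(y)|Ff(y)|^q\,dy\bigg)^{1/q}\lesssim\bigg(\int_0^\infty x^{p(1/p'+b_0+b_1)}|f(x)|^p\,dx\bigg)^{1/p}$$ (with the usual modification of the left-hand side if $q=\infty$) cannot hold, with a constant independent of $f$, for all $f$ satisfying $\int_0^\infty x^{b_0+b_1}f(x)\,dx=0$.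
   Context: A weight is a nonnegative locally integrable function on $(0,\infty)$. $p'=p/(p-1)$. For $q=\infty$ the left-hand side is understood as $\operatorname{ess\,sup}_{y>0}u(y)|Ff(y)|$. Functions $f:(0,\infty)\to\mathbb{C}$ are measurable with $\int_0^1x^{b_0+b_1}|f(x)|\,dx+\int_1^\infty x^{b_0+b_2}|f(x)|\,dx<\infty$, so that $Ff(y)$ is well defined, and with $x^{b_0+b_1}f(x)$ integrable on $(0,\infty)$. $A\lesssim B$ means $A\le cB$ with $c>0$ independent of $f$. *)

theory Defs
  imports "HOL-Analysis.Analysis" "HOL-Probability.Essential_Supremum"
begin

abbreviation pos_lebesgue :: "real measure" where
  "pos_lebesgue \<equiv> lebesgue_on {0<..}"

definition weight :: "(real \<Rightarrow> real) \<Rightarrow> bool" where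
  "weight u \<longleftrightarrow> (\<forall>x>0. 0 \<le> u x) \<and>
     (\<forall>S. compact S \<and> S \<subseteq> {0<..} \<longrightarrow> integrable (lebesgue_on S) u)"

definition conj_exp :: "real \<Rightarrow> real" where
  "conj_exp p = p / (p - 1)"

definition kernel ::
  "(nat \<Rightarrow> complex) \<Rightarrow> nat \<Rightarrow> real \<Rightarrow> real \<Rightarrow> real \<Rightarrow> real \<Rightarrow> complex" where
  "kernel a k b1 c1 x y =
     complex_of_real (x powr b1 * y powr c1) *
     (\<Sum>m. a m * complex_of_real ((x * y) ^ (k * m)))"

definition transform ::
  "real \<Rightarrow> real \<Rightarrow> (real \<Rightarrow> real \<Rightarrow> complex) \<Rightarrow> (real \<Rightarrow> complex) \<Rightarrow> real \<Rightarrow> complex" where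
  "transform b0 c0 K f y =
     complex_of_real (y powr c0) *
     (LINT x|pos_lebesgue. complex_of_real (x powr b0) * f x * K x y)"

definition admissible :: "real \<Rightarrow> real \<Rightarrow> real \<Rightarrow> (real \<Rightarrow> complex) \<Rightarrow> bool" where
  "admissible b0 b1 b2 f \<longleftrightarrow>
     f \<in> borel_measurable pos_lebesgue \<and>
     integrable (lebesgue_on {0<..1}) (\<lambda>x. x powr (b0 + b1) * cmod (f x)) \<and>
     integrable (lebesgue_on {1..}) (\<lambda>x. x powr (b0 + b2) * cmod (f x)) \<and>
     integrable pos_lebesgue (\<lambda>x. complex_of_real (x powr (b0 + b1)) * f x)"

text \<open>The real power of an extended nonnegative number, for exponents r > 0.\<close>
definition ennreal_rpow :: "ennreal \<Rightarrow> real \<Rightarrow> ennreal" where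
  "ennreal_rpow I r = (if I = \<infinity> then \<infinity> else ennreal (enn2real I powr r))"

text \<open>The weight is outside the power: for finite q this is the q-th root of the integral
  of u |g|^q, and for infinite q it is the essential supremum of u |g|. The value may be
  infinite.\<close>
definition weighted_norm :: "ennreal \<Rightarrow> (real \<Rightarrow> real) \<Rightarrow> (real \<Rightarrow> complex) \<Rightarrow> ennreal" where
  "weighted_norm q u g =
     (if q = \<infinity> then esssup pos_lebesgue (\<lambda>y. ennreal (u y * cmod (g y)))
      else ennreal_rpow
             (\<integral>\<^sup>+ y. ennreal (u y * cmod (g y) powr enn2real q) \<partial>pos_lebesgue)
             (1 / enn2real q))"

end

theory Submission
  imports Defs
begin

text \<open>
  With \<open>g x = x powr (b0 + b1) * f x\<close> and the entire function \<open>E z = (\<Sum>m. a m * z ^ m)\<close>, the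
  transform becomes
  \<open>Ff(y) = y powr (c0 + c1) * \<integral> g(x) E((xy)^k) dx\<close>, and the right-hand side of the inequality becomes
  \<open>(\<integral> x powr (p - 1) * |g(x)| powr p dx) powr (1 / p)\<close>, which is the \<open>L\<^sup>p\<close> norm of \<open>x g(x)\<close>
  for the measure \<open>dx / x\<close>. A plateau \<open>x g(x) = 1 / L\<close> on an interval of logarithmic length \<open>L\<close> has
  mass \<open>\<integral> g = 1\<close>, but its norm \<open>L powr (1 / p - 1)\<close> tends to 0, because \<open>p > 1\<close>.

  Take for \<open>g\<close> the difference of two such plateaus, one on \<open>[exp (-2L), exp (-L)]\<close> and one on
  \<open>[exp L, exp (2L)]\<close>. It has integral zero and small norm. On the left plateau \<open>xy\<close> is small, so
  \<open>E((xy)^k)\<close> is close to \<open>a 0\<close> and this part contributes almost \<open>a 0 * y powr (c0 + c1)\<close> to \<open>Ff(y)\<close>.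
  The right plateau contributes almost nothing, because \<open>x powr \<nu> * K x y\<close> has the primitive \<open>G y\<close>:
  integration by parts gains the factor \<open>exp L powr (b - b1 - \<nu> - 1)\<close>
  (\<open>norm_integral_le_of_primitive\<close>), and the exponent is negative. Both estimates are uniform for \<open>y\<close>
  in a compact interval, so there \<open>|Ff|\<close> stays above a fixed \<open>\<delta> > 0\<close> as \<open>L\<close> grows
  (\<open>transform_dipole_test_lower_bound\<close>), while the right-hand side of the inequality tends to 0. An
  inequality with a constant would then force the weight to vanish almost everywhere on every compact
  interval (\<open>weight_zero_AE_of_small_norm\<close>).
\<close>

section \<open>The kernel as an entire function\<close>

text \<open>
  Convergence at the points \<open>t ^ k\<close> with \<open>t > 0\<close> already forces an infinite radius of
  convergence, because these points are unbounded.
\<close>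
lemma continuous_on_power_series_of_kernel:
  fixes a :: "nat \<Rightarrow> complex"
  assumes "k \<ge> 1"
    and summ: "\<And>x y. x > 0 \<Longrightarrow> y > 0 \<Longrightarrow>
           summable (\<lambda>m. a m * complex_of_real ((x * y) ^ (k * m)))"
  shows "continuous_on UNIV (\<lambda>z. \<Sum>m. a m * z ^ m)"
proof -
  have "summable (\<lambda>m. a m * z ^ m)" for z
  proof (rule powser_inside)
    let ?t = "1 + cmod z"
    show "summable (\<lambda>m. a m * complex_of_real (?t ^ k) ^ m)"
      using summ[of ?t 1] by (simp add: power_mult add_pos_nonneg)
    have "cmod z < ?t ^ 1" by simp
    also have "\<dots> \<le> ?t ^ k"
      using \<open>k \<ge> 1\<close> by (intro power_increasing) auto
    finally show "cmod z < cmod (complex_of_real (?t ^ k))"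
      by (simp del: of_real_power)
  qed
  then show ?thesis
    by (simp add: continuous_on_eq_continuous_at isCont_powser_converges_everywhere)
qed

lemma kernel_eq_power_series:
  "kernel a k b1 c1 x y =
     complex_of_real (x powr b1 * y powr c1) *
     (\<Sum>m. a m * complex_of_real ((x * y) ^ k) ^ m)"
  by (simp add: kernel_def power_mult)

section \<open>Two logarithmic plateaus of opposite sign\<close>

text \<open>
  The factor \<open>1 / (L * x)\<close> gives each plateau mass 1, since both intervals have logarithmic length \<open>L\<close>.
  As \<open>L\<close> grows one interval moves to 0 and the other to infinity.
\<close>
definition dipole :: "real \<Rightarrow> real \<Rightarrow> real" where
  "dipole L x =
     (indicator {exp (- 2 * L)..exp (- L)} x - indicator {exp L..exp (2 * L)} x) / (L * x)"

lemma has_bochner_integral_interval_pos_lebesgue: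
  fixes h :: "real \<Rightarrow> 'b::euclidean_space"
  assumes "0 < s" and cont: "continuous_on {0<..} h"
  shows "has_bochner_integral pos_lebesgue (\<lambda>x. indicator {s..t} x *\<^sub>R h x) (integral {s..t} h)"
proof -
  have int: "integrable (lebesgue_on {s..t}) h"
    using assms by (intro continuous_imp_integrable_real continuous_on_subset[OF cont]) auto
  have "has_bochner_integral (lebesgue_on {s..t}) h (integral {s..t} h)"
    using int lebesgue_integral_eq_integral[OF int] by (simp add: has_bochner_integral_iff)
  moreover have "(\<lambda>x. indicator {0<..} x *\<^sub>R indicator {s..t} x *\<^sub>R h x)
      = (\<lambda>x. indicator {s..t} x *\<^sub>R h x)"
    using \<open>0 < s\<close> by (auto simp: indicator_def)
  ultimately show ?thesis
    by (simp add: has_bochner_integral_restrict_space del: scaleR_scaleR)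
qed

lemma has_bochner_integral_dipole:
  fixes h :: "real \<Rightarrow> 'b::euclidean_space"
  assumes "continuous_on {0<..} h"
  shows "has_bochner_integral pos_lebesgue (\<lambda>x. dipole L x *\<^sub>R h x)
     ((integral {exp (- 2 * L)..exp (- L)} (\<lambda>x. h x /\<^sub>R x)
       - integral {exp L..exp (2 * L)} (\<lambda>x. h x /\<^sub>R x)) /\<^sub>R L)"
proof -
  have cont: "continuous_on {0<..} (\<lambda>x. h x /\<^sub>R x)"
    using assms by (intro continuous_intros) auto
  have "has_bochner_integral pos_lebesgue
      (\<lambda>x. (indicator {exp (- 2 * L)..exp (- L)} x *\<^sub>R (h x /\<^sub>R x)
            - indicator {exp L..exp (2 * L)} x *\<^sub>R (h x /\<^sub>R x)) /\<^sub>R L)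
     ((integral {exp (- 2 * L)..exp (- L)} (\<lambda>x. h x /\<^sub>R x)
       - integral {exp L..exp (2 * L)} (\<lambda>x. h x /\<^sub>R x)) /\<^sub>R L)"
    by (intro has_bochner_integral_scaleR_right has_bochner_integral_diff
        has_bochner_integral_interval_pos_lebesgue cont) auto
  moreover have "(indicator {exp (- 2 * L)..exp (- L)} x *\<^sub>R (h x /\<^sub>R x)
            - indicator {exp L..exp (2 * L)} x *\<^sub>R (h x /\<^sub>R x)) /\<^sub>R L = dipole L x *\<^sub>R h x" for x
    by (simp add: dipole_def divide_inverse flip: scaleR_diff_left) (simp add: algebra_simps)
  ultimately show ?thesis by simp
qed

lemma has_integral_inverse_exp:
  assumes "s \<le> t"
  shows "((\<lambda>x. 1 / x) has_integral (t - s)) {exp s..exp t :: real}"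
proof -
  have "((\<lambda>x. 1 / x) has_integral (ln (exp t) - ln (exp s))) {exp s..exp t :: real}"
  proof (rule fundamental_theorem_of_calculus)
    fix x :: real assume "x \<in> {exp s..exp t}"
    then have "0 < x" using exp_gt_zero[of s] by (simp del: exp_gt_zero)
    then show "(ln has_vector_derivative 1 / x) (at x within {exp s..exp t})"
      by (auto intro!: derivative_eq_intros
          simp flip: has_real_derivative_iff_has_vector_derivative)
  qed (use assms in simp)
  then show ?thesis by simp
qed

lemma abs_dipole:
  assumes "L > 0" "x > 0"
  shows "\<bar>dipole L x\<bar> =
    (indicator {exp (- 2 * L)..exp (- L)} x + indicator {exp L..exp (2 * L)} x) / (L * x)"
proof -
  have "exp (- L) < exp L" using assms by (simp del: exp_minus)
  then have "\<not> (x \<le> exp (- L) \<and> exp L \<le> x)" by linarith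
  then show ?thesis
    using assms by (auto simp: dipole_def indicator_def)
qed

lemma integral_dipole:
  assumes "L > 0"
  shows "(LINT x|pos_lebesgue. dipole L x) = 0"
proof -
  have "has_bochner_integral pos_lebesgue (\<lambda>x. dipole L x *\<^sub>R (1::real))
     ((integral {exp (- 2 * L)..exp (- L)} (\<lambda>x. 1 /\<^sub>R x)
       - integral {exp L..exp (2 * L)} (\<lambda>x. 1 /\<^sub>R x)) /\<^sub>R L)"
    by (rule has_bochner_integral_dipole) (rule continuous_on_const)
  moreover have "integral {exp (- 2 * L)..exp (- L)} (\<lambda>x. 1 / x) = L"
    using has_integral_inverse_exp[of "- 2 * L" "- L"] assms by (simp add: integral_unique)
  moreover have "integral {exp L..exp (2 * L)} (\<lambda>x. 1 / x) = L"
    using has_integral_inverse_exp[of L "2 * L"] assms by (simp add: integral_unique)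
  ultimately show ?thesis
    by (simp add: has_bochner_integral_iff divide_inverse)
qed

text \<open>
  This is the \<open>p\<close>-th power of the norm of \<open>x * dipole L x\<close> in \<open>L\<^sup>p(dx / x)\<close>, a function of
  modulus \<open>1 / L\<close> on a set of measure \<open>2 * L\<close>. For \<open>p > 1\<close> this tends to 0 as \<open>L\<close> grows.
\<close>
lemma nn_integral_dipole:
  assumes "L > 0"
  shows "(\<integral>\<^sup>+ x. ennreal (x powr (p - 1) * \<bar>dipole L x\<bar> powr p) \<partial>pos_lebesgue) = ennreal (2 * L powr (1 - p))"
proof -
  let ?I = "{exp (- 2 * L)..exp (- L)}" and ?J = "{exp L..exp (2 * L)}"
  let ?h = "\<lambda>x. indicator ?I x *\<^sub>R (1 / x) + indicator ?J x *\<^sub>R (1 / x) :: real"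
  have "has_bochner_integral pos_lebesgue ?h
    (integral ?I (\<lambda>x. 1 / x) + integral ?J (\<lambda>x. 1 / x))"
    by (intro has_bochner_integral_add has_bochner_integral_interval_pos_lebesgue
        continuous_intros) auto
  moreover have "integral ?I (\<lambda>x. 1 / x) = L"
    using has_integral_inverse_exp[of "- 2 * L" "- L"] assms by (simp add: integral_unique)
  moreover have "integral ?J (\<lambda>x. 1 / x) = L"
    using has_integral_inverse_exp[of L "2 * L"] assms by (simp add: integral_unique)
  ultimately have h: "has_bochner_integral pos_lebesgue (\<lambda>x. L powr - p * ?h x) (L powr - p * (2 * L))"
    by (intro has_bochner_integral_mult_right) simp
  have eq: "x powr (p - 1) * \<bar>dipole L x\<bar> powr p = L powr - p * ?h x" if "x > 0" for x
  proof -
    have "exp (- L) < exp L" using assms by simp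
    then have "\<not> (x \<le> exp (- L) \<and> exp L \<le> x)" by linarith
    then show ?thesis
      unfolding abs_dipole[OF assms that] using that assms
      by (auto simp: indicator_def powr_divide powr_mult powr_minus powr_diff field_simps)
  qed
  have "(\<integral>\<^sup>+ x. ennreal (x powr (p - 1) * \<bar>dipole L x\<bar> powr p) \<partial>pos_lebesgue)
      = (\<integral>\<^sup>+ x. ennreal (L powr - p * ?h x) \<partial>pos_lebesgue)"
    using eq by (intro nn_integral_cong) simp
  also have "\<dots> = ennreal (L powr - p * (2 * L))"
    using h by (subst nn_integral_eq_integral)
      (auto simp: has_bochner_integral_iff intro!: AE_I2 mult_nonneg_nonneg add_nonneg_nonneg)
  also have "L powr - p * (2 * L) = 2 * L powr (1 - p)"
    using assms by (simp add: powr_diff powr_minus field_simps)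
  finally show ?thesis .
qed

section \<open>Oscillatory integrals with a controlled primitive\<close>

text \<open>
  Integration by parts: both the boundary terms \<open>x powr e * g x\<close> and the integrand
  \<open>e * x powr (e - 1) * g x\<close> that remains are controlled by the growth of \<open>g\<close>, and a negative exponent
  \<open>\<beta> + e\<close> makes that integrand integrable up to infinity, so that the bound does not depend on \<open>t\<close>.
  The 2 counts the two boundary terms.
\<close>
lemma norm_integral_le_of_primitive:
  fixes g h :: "real \<Rightarrow> complex"
  assumes "0 < s" "s \<le> t"
    and deriv: "\<And>x. x \<in> {s..t} \<Longrightarrow> (g has_vector_derivative h x) (at x)"
    and bound: "\<And>x. x \<in> {s..t} \<Longrightarrow> cmod (g x) \<le> M * x powr \<beta>"
    and "\<beta> + e < 0"
  shows "cmod (integral {s..t} (\<lambda>x. complex_of_real (x powr e) * h x))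
     \<le> M * (2 + \<bar>e\<bar> / - (\<beta> + e)) * s powr (\<beta> + e)"
proof -
  define \<theta> where "\<theta> = - (\<beta> + e)"
  have \<theta>: "\<theta> > 0" "\<beta> + e = - \<theta>" using assms by (auto simp: \<theta>_def)
  have pos: "0 < x" if "x \<in> {s..t}" for x using that \<open>0 < s\<close> by auto
  have "0 \<le> M * s powr \<beta>"
    using order_trans[OF norm_ge_zero bound[of s]] \<open>s \<le> t\<close> by simp
  then have M: "0 \<le> M" using \<open>0 < s\<close> by (simp add: zero_le_mult_iff)
  define B where "B x = complex_of_real (x powr e) * g x" for x
  define E where "E x = complex_of_real (e * x powr (e - 1)) * g x" for x
  have "(B has_vector_derivative E x + complex_of_real (x powr e) * h x) (at x within {s..t})"
    if "x \<in> {s..t}" for x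
  proof -
    have "((\<lambda>x. complex_of_real (x powr e)) has_vector_derivative
        complex_of_real (e * x powr (e - 1))) (at x)"
      using pos[OF that]
      by (intro has_vector_derivative_of_real)
         (auto intro!: derivative_eq_intros
           simp: field_simps powr_diff)
    from has_vector_derivative_mult[OF this deriv[OF that]]
    show ?thesis
      unfolding B_def E_def
      by (auto intro: has_vector_derivative_at_within simp: add.commute)
  qed
  then have ftc: "((\<lambda>x. E x + complex_of_real (x powr e) * h x) has_integral B t - B s) {s..t}"
    using \<open>s \<le> t\<close> by (intro fundamental_theorem_of_calculus) auto
  have "continuous_on {s..t} g"
    using deriv by (meson continuous_at_imp_continuous_on has_vector_derivative_continuous)
  then have "continuous_on {s..t} E"
    unfolding E_def using pos by (intro continuous_intros) (auto dest: pos)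
  then have E: "E integrable_on {s..t}"
    by (rule integrable_continuous_interval)
  have h: "integral {s..t} (\<lambda>x. complex_of_real (x powr e) * h x) = B t - B s - integral {s..t} E"
    using has_integral_diff[OF ftc integrable_integral[OF E]] by (simp add: integral_unique)
  have B: "cmod (B x) \<le> M * s powr (- \<theta>)" if "x \<in> {s..t}" for x
  proof -
    have "cmod (B x) \<le> x powr e * (M * x powr \<beta>)"
      unfolding B_def by (auto simp: norm_mult intro!: mult_left_mono bound that)
    also have "\<dots> = M * x powr (- \<theta>)"
      by (simp add: algebra_simps flip: powr_add \<theta>(2))
    also have "\<dots> \<le> M * s powr (- \<theta>)"
      using that \<open>0 < s\<close> \<theta> M by (intro mult_left_mono powr_mono2') auto
    finally show ?thesis .
  qed
  have ftc2: "((\<lambda>x. M * \<bar>e\<bar> * x powr (- \<theta> - 1)) has_integral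
      (- (M * \<bar>e\<bar> / \<theta>) * t powr - \<theta> - - (M * \<bar>e\<bar> / \<theta>) * s powr - \<theta>)) {s..t}"
  proof (rule fundamental_theorem_of_calculus[OF \<open>s \<le> t\<close>])
    fix x assume "x \<in> {s..t}"
    then show "((\<lambda>x. - (M * \<bar>e\<bar> / \<theta>) * x powr - \<theta>) has_vector_derivative
        M * \<bar>e\<bar> * x powr (- \<theta> - 1)) (at x within {s..t})"
      using \<theta>(1) pos[of x]
      by (auto intro!: derivative_eq_intros
          simp: powr_diff field_simps simp flip: has_real_derivative_iff_has_vector_derivative)
  qed
  have "cmod (integral {s..t} E) \<le> integral {s..t} (\<lambda>x. M * \<bar>e\<bar> * x powr (- \<theta> - 1))"
  proof (rule integral_norm_bound_integral[OF E])
    fix x assume x: "x \<in> {s..t}"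
    have "cmod (E x) \<le> \<bar>e\<bar> * x powr (e - 1) * (M * x powr \<beta>)"
      unfolding E_def by (auto simp: norm_mult abs_mult intro!: mult_left_mono bound x)
    also have "\<dots> = M * \<bar>e\<bar> * x powr (- \<theta> - 1)"
      by (simp add: algebra_simps flip: powr_add \<theta>(2))
    finally show "cmod (E x) \<le> M * \<bar>e\<bar> * x powr (- \<theta> - 1)" .
  qed (use ftc2 in blast)
  also have "\<dots> \<le> M * \<bar>e\<bar> / \<theta> * s powr (- \<theta>)"
    using integral_unique[OF ftc2] M \<theta> by simp
  finally have "cmod (integral {s..t} E) \<le> M * \<bar>e\<bar> / \<theta> * s powr (- \<theta>)" .
  moreover have "cmod (B t) \<le> M * s powr (- \<theta>)" "cmod (B s) \<le> M * s powr (- \<theta>)"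
    using B \<open>s \<le> t\<close> by auto
  moreover have "cmod (B t - B s - integral {s..t} E) \<le> cmod (B t) + cmod (B s) + cmod (integral {s..t} E)"
    using norm_triangle_ineq4[of "B t - B s" "integral {s..t} E"] norm_triangle_ineq4[of "B t" "B s"]
    by linarith
  ultimately show ?thesis
    unfolding h \<theta> by (simp add: algebra_simps)
qed

section \<open>The test functions\<close>

text \<open>
  The factor \<open>x powr (- \<beta>)\<close>, used with \<open>\<beta> = b0 + b1\<close>, cancels the weight \<open>x powr (b0 + b1)\<close> of the
  cancellation condition, so that this condition becomes \<open>integral_dipole\<close>.
\<close>
definition dipole_test :: "real \<Rightarrow> real \<Rightarrow> real \<Rightarrow> complex" where
  "dipole_test \<beta> L x = complex_of_real (x powr (- \<beta>) * dipole L x)"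

lemma admissible_dipole_test:
  "admissible b0 b1 b2 (dipole_test (b0 + b1) L)"
proof -
  have int: "integrable pos_lebesgue (\<lambda>x. dipole L x *\<^sub>R complex_of_real (x powr e))" for e
    using has_bochner_integral_dipole[of "\<lambda>x. complex_of_real (x powr e)" L]
    by (force simp: has_bochner_integral_iff intro!: continuous_intros)
  have int_abs: "integrable (lebesgue_on S) (\<lambda>x. x powr e * cmod (dipole_test (b0 + b1) L x))"
    if "S \<subseteq> {0<..}" "S \<in> sets lebesgue" for S e
  proof -
    have "integrable pos_lebesgue (\<lambda>x. x powr e * cmod (dipole_test (b0 + b1) L x))"
      by (rule integrable_norm[OF int[of "e - (b0 + b1)"], THEN Bochner_Integration.integrable_cong[THEN iffD1, rotated -1]])
        (auto simp: dipole_test_def norm_mult norm_divide abs_mult powr_add powr_diff powr_minus field_simps)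
    then have "set_integrable lebesgue {0<..} (\<lambda>x. x powr e * cmod (dipole_test (b0 + b1) L x))"
      by (simp add: set_integrable_def integrable_restrict_space)
    then have "set_integrable lebesgue S (\<lambda>x. x powr e * cmod (dipole_test (b0 + b1) L x))"
      by (rule set_integrable_subset) (use that in auto)
    then show ?thesis
      using that by (simp add: set_integrable_def integrable_restrict_space)
  qed
  have eq: "complex_of_real (x powr e) * dipole_test (b0 + b1) L x
      = dipole L x *\<^sub>R complex_of_real (x powr (e - (b0 + b1)))" if "x > 0" for x e
    using that
    by (simp add: dipole_test_def scaleR_conv_of_real powr_diff powr_add powr_minus field_simps)
  have "integrable pos_lebesgue (\<lambda>x. complex_of_real (x powr e) * dipole_test (b0 + b1) L x)" for e
    using int[of "e - (b0 + b1)"]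
    by (rule Bochner_Integration.integrable_cong[THEN iffD1, rotated -1]) (simp_all add: eq)
  note int_f = this
  \<comment> \<open>For \<open>e = 0\<close> the power is 1 on the half-line, so integrability gives measurability of the
    test function itself.\<close>
  have "dipole_test (b0 + b1) L \<in> borel_measurable pos_lebesgue"
    using borel_measurable_integrable[OF int_f[of 0]]
    by (rule measurable_cong[THEN iffD1, rotated]) simp
  then show ?thesis
    unfolding admissible_def by (auto intro!: int_abs int_f)
qed

lemma integral_dipole_test:
  assumes "L > 0"
  shows "(LINT x|pos_lebesgue. complex_of_real (x powr \<beta>) * dipole_test \<beta> L x) = 0"
proof -
  have "(LINT x|pos_lebesgue. complex_of_real (x powr \<beta>) * dipole_test \<beta> L x)
      = (LINT x|pos_lebesgue. complex_of_real (dipole L x))"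
    by (intro Bochner_Integration.integral_cong)
      (auto simp: dipole_test_def powr_minus field_simps)
  then show ?thesis
    by (simp add: integral_dipole assms)
qed

lemma weighted_norm_dipole_test:
  assumes "p > 1" "L > 0"
  shows "weighted_norm (ennreal p) (\<lambda>x. x powr (p * (1 / conj_exp p + b0 + b1)))
     (dipole_test (b0 + b1) L) = ennreal ((2 * L powr (1 - p)) powr (1 / p))"
proof -
  have "x powr (p * (1 / conj_exp p + b0 + b1)) * cmod (dipole_test (b0 + b1) L x) powr p
      = x powr (p - 1) * \<bar>dipole L x\<bar> powr p" if "x > 0" for x
  proof -
    have "p * (1 / conj_exp p + b0 + b1) = (p - 1) + (b0 + b1) * p"
      using assms by (simp add: conj_exp_def field_simps)
    then have "x powr (p * (1 / conj_exp p + b0 + b1)) = x powr (p - 1) * (x powr (b0 + b1)) powr p"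
      by (simp only: powr_add[of x "p - 1"] powr_powr)
    moreover have "(x powr (b0 + b1)) powr p * (x powr - (b0 + b1)) powr p = 1"
      using that by (simp add: powr_powr flip: powr_add distrib_right)
    ultimately show ?thesis
      by (simp add: dipole_test_def norm_mult abs_mult powr_mult)
  qed
  then have "(\<integral>\<^sup>+ x. ennreal (x powr (p * (1 / conj_exp p + b0 + b1))
        * cmod (dipole_test (b0 + b1) L x) powr p) \<partial>pos_lebesgue)
      = ennreal (2 * L powr (1 - p))"
    by (subst nn_integral_dipole[OF assms(2), symmetric]) (intro nn_integral_cong, simp)
  then show ?thesis
    using assms by (simp add: weighted_norm_def ennreal_rpow_def)
qed

lemma transform_dipole_test:
  assumes "y > 0" and cont: "continuous_on {0<..} (\<lambda>x. K x y)"
  shows "transform b0 c0 K (dipole_test (b0 + b1) L) y =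
    complex_of_real (y powr c0) *
    ((integral {exp (- 2 * L)..exp (- L)} (\<lambda>x. complex_of_real (x powr (- 1 - b1)) * K x y)
     - integral {exp L..exp (2 * L)} (\<lambda>x. complex_of_real (x powr (- 1 - b1)) * K x y)) /\<^sub>R L)"
proof -
  let ?h = "\<lambda>x. complex_of_real (x powr (- b1)) * K x y"
  have h: "continuous_on {0<..} ?h"
    by (intro continuous_intros cont) auto
  have "(LINT x|pos_lebesgue. complex_of_real (x powr b0) * dipole_test (b0 + b1) L x * K x y)
      = (LINT x|pos_lebesgue. dipole L x *\<^sub>R ?h x)"
    by (intro Bochner_Integration.integral_cong)
      (auto simp: dipole_test_def scaleR_conv_of_real powr_add powr_minus powr_diff field_simps)
  also have "\<dots> = (integral {exp (- 2 * L)..exp (- L)} (\<lambda>x. ?h x /\<^sub>R x)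
       - integral {exp L..exp (2 * L)} (\<lambda>x. ?h x /\<^sub>R x)) /\<^sub>R L"
    using has_bochner_integral_dipole[OF h] by (simp only: has_bochner_integral_iff)
  finally have eq: "(LINT x|pos_lebesgue. complex_of_real (x powr b0) * dipole_test (b0 + b1) L x * K x y)
      = \<dots>" .
  have "integral {exp s..t} (\<lambda>x. ?h x /\<^sub>R x)
      = integral {exp s..t} (\<lambda>x. complex_of_real (x powr (- 1 - b1)) * K x y)" for s t
  proof (rule integral_cong)
    fix x :: real assume "x \<in> {exp s..t}"
    then have "x > 0" using exp_gt_zero[of s] by (simp del: exp_gt_zero)
    then show "?h x /\<^sub>R x = complex_of_real (x powr (- 1 - b1)) * K x y"
      by (simp add: scaleR_conv_of_real powr_diff powr_minus field_simps)
  qed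
  then show ?thesis
    by (simp only: transform_def eq)
qed

section \<open>Weights for which functions bounded below have small norm\<close>

text \<open>
  For finite \<open>q\<close>, a norm at most \<open>\<epsilon>\<close> together with \<open>|g| \<ge> \<delta>\<close> on \<open>S\<close> bounds the integral of the weight
  over \<open>S\<close> by \<open>(\<epsilon> / \<delta>) powr q\<close>; for infinite \<open>q\<close> it bounds the weight itself by \<open>\<epsilon> / \<delta>\<close> almost
  everywhere on \<open>S\<close>. Both bounds hold for an arbitrary function \<open>g\<close>: the lower integral is monotone
  even on non-measurable integrands, and the essential supremum of a non-measurable function is infinite.
\<close>
lemma weight_zero_AE_of_small_norm:
  fixes q :: ennreal and u :: "real \<Rightarrow> real"
  assumes "0 < q" and S: "S \<in> sets lebesgue" "S \<subseteq> {0<..}"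
    and u: "u \<in> borel_measurable (lebesgue_on S)" "\<And>y. y \<in> S \<Longrightarrow> 0 \<le> u y"
    and "\<delta> > 0"
    and small: "\<And>\<epsilon>. \<epsilon> > 0 \<Longrightarrow> \<exists>g. weighted_norm q u g \<le> ennreal \<epsilon> \<and> (\<forall>y\<in>S. \<delta> \<le> cmod (g y))"
  shows "AE y in lebesgue_on S. u y = 0"
proof (cases "q = \<infinity>")
  case True
  have "AE y in lebesgue_on S. u y * \<delta> \<le> 1 / Suc n" for n
  proof -
    obtain g where g: "weighted_norm q u g \<le> ennreal (1 / Suc n)" "\<forall>y\<in>S. \<delta> \<le> cmod (g y)"
      using small[of "1 / Suc n"] by auto
    have "AE y in pos_lebesgue. ennreal (u y * cmod (g y)) \<le> ennreal (1 / Suc n)"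
      using g(1) unfolding weighted_norm_def if_P[OF True]
      by (intro eventually_mono[OF esssup_AE[of "\<lambda>y. ennreal (u y * cmod (g y))" pos_lebesgue]])
        (rule order_trans)
    then have "AE y in lebesgue. y \<in> {0<..} \<longrightarrow> ennreal (u y * cmod (g y)) \<le> ennreal (1 / Suc n)"
      by (simp add: AE_restrict_space_iff)
    then have "AE y in lebesgue. y \<in> S \<longrightarrow> u y * \<delta> \<le> 1 / Suc n"
    proof eventually_elim
      case (elim y)
      show ?case
      proof
        assume y: "y \<in> S"
        then have "u y * \<delta> \<le> u y * cmod (g y)"
          using g(2) u(2) by (intro mult_left_mono) auto
        also have "\<dots> \<le> 1 / Suc n"
          using elim y S(2) by (auto simp: ennreal_le_iff)
        finally show "u y * \<delta> \<le> 1 / Suc n" .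
      qed
    qed
    then show ?thesis
      using S(1) by (simp add: AE_restrict_space_iff)
  qed
  then have "AE y in lebesgue_on S. \<forall>n. u y * \<delta> \<le> 1 / Suc n"
    by (simp add: AE_all_countable)
  then have "AE y in lebesgue_on S. y \<in> S \<and> (\<forall>n. u y * \<delta> \<le> 1 / Suc n)"
    using AE_space[of "lebesgue_on S"] by eventually_elim simp
  then show ?thesis
  proof eventually_elim
    case (elim y)
    have "u y * \<delta> \<le> 0"
    proof (rule ccontr)
      assume "\<not> u y * \<delta> \<le> 0"
      then obtain n where "inverse (real (Suc n)) < u y * \<delta>"
        using reals_Archimedean[of "u y * \<delta>"] by auto
      moreover have "u y * \<delta> \<le> inverse (real (Suc n))"
        unfolding inverse_eq_divide using elim by blast
      ultimately show False by linarith
    qed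
    with \<open>\<delta> > 0\<close> u(2)[of y] elim show ?case
      by (simp add: mult_le_0_iff)
  qed
next
  case False
  define r where "r = enn2real q"
  have r: "r > 0"
    using \<open>0 < q\<close> False by (simp add: r_def enn2real_positive_iff less_top)
  \<comment> \<open>The summand 0 gives the shape of \<open>ennreal_le_epsilon\<close>.\<close>
  have "(\<integral>\<^sup>+ y. ennreal (u y) \<partial>lebesgue_on S) \<le> 0 + ennreal e" if "e > 0" for e
  proof -
    \<comment> \<open>Chosen so that \<open>(\<epsilon> / \<delta>) powr r = e\<close>.\<close>
    define \<epsilon> where "\<epsilon> = \<delta> * e powr (1 / r)"
    have "\<epsilon> > 0" using \<open>\<delta> > 0\<close> that by (simp add: \<epsilon>_def)
    then obtain g where g: "weighted_norm q u g \<le> ennreal \<epsilon>" "\<forall>y\<in>S. \<delta> \<le> cmod (g y)"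
      using small by blast
    define I where "I = (\<integral>\<^sup>+ y. ennreal (u y * cmod (g y) powr r) \<partial>pos_lebesgue)"
    have rp: "ennreal_rpow I (1 / r) \<le> ennreal \<epsilon>"
      using g(1) False by (simp add: weighted_norm_def I_def r_def)
    then have "I \<noteq> \<infinity>" "enn2real I powr (1 / r) \<le> \<epsilon>"
      using \<open>\<epsilon> > 0\<close> by (auto simp: ennreal_rpow_def top_unique split: if_splits)
    then have "(enn2real I powr (1 / r)) powr r \<le> \<epsilon> powr r"
      using r by (intro powr_mono2) auto
    then have "enn2real I \<le> \<delta> powr r * e"
      using r \<open>\<delta> > 0\<close> that by (simp add: \<epsilon>_def powr_powr powr_mult)
    then have I: "I \<le> ennreal (\<delta> powr r * e)"
      using ennreal_leI[of "enn2real I" "\<delta> powr r * e"] \<open>I \<noteq> \<infinity>\<close> by (simp add: less_top)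
    have "ennreal (\<delta> powr r) * (\<integral>\<^sup>+ y. ennreal (u y) \<partial>lebesgue_on S)
        = (\<integral>\<^sup>+ y. ennreal (\<delta> powr r) * ennreal (u y) \<partial>lebesgue_on S)"
      using u(1) by (intro nn_integral_cmult[symmetric]) measurable
    also have "\<dots> \<le> (\<integral>\<^sup>+ y. ennreal (u y * cmod (g y) powr r) \<partial>lebesgue_on S)"
    proof (rule nn_integral_mono)
      fix y assume "y \<in> space (lebesgue_on S)"
      then have y: "y \<in> S" by simp
      have "\<delta> powr r * u y \<le> u y * cmod (g y) powr r"
        using g(2) y u(2)[OF y] r \<open>\<delta> > 0\<close>
        by (subst mult.commute, intro mult_left_mono powr_mono2) auto
      then show "ennreal (\<delta> powr r) * ennreal (u y) \<le> ennreal (u y * cmod (g y) powr r)"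
        using u(2)[OF y] by (simp add: ennreal_leI flip: ennreal_mult)
    qed
    also have "\<dots> \<le> I"
      unfolding I_def using S
      by (simp add: nn_integral_restrict_space)
        (intro nn_integral_mono mult_left_mono, auto simp: indicator_def)
    also note I
    also have "ennreal (\<delta> powr r * e) = ennreal (\<delta> powr r) * ennreal e"
      using that by (simp add: ennreal_mult)
    finally show ?thesis
      using \<open>\<delta> > 0\<close> by (simp add: ennreal_mult_le_mult_iff)
  qed
  then have "(\<integral>\<^sup>+ y. ennreal (u y) \<partial>lebesgue_on S) \<le> 0"
    by (rule ennreal_le_epsilon)
  then have "AE y in lebesgue_on S. ennreal (u y) = 0"
    using u(1) by (subst nn_integral_0_iff_AE[symmetric]) auto
  then show ?thesis
    using AE_space[of "lebesgue_on S"]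
  proof eventually_elim
    case (elim y)
    then show ?case using u(2)[of y] by (simp add: ennreal_eq_0_iff)
  qed
qed

section \<open>The transform of the test functions stays away from zero\<close>

text \<open>
  Up to the factor \<open>y powr c0 / L\<close> the transform is \<open>P - Q\<close>, where \<open>P\<close> comes from the left plateau and \<open>Q\<close>
  from the right one. Here \<open>P\<close> is within a quarter of its size of \<open>a 0 * y powr c1 * L\<close>, by continuity of
  the power series at 0, and \<open>Q\<close> is at most a quarter of that size, by the bound for the primitive \<open>G y\<close>.
  So half of the main term survives. Compactness of the interval enters only to bound the powers of \<open>y\<close>
  from above and from below.
\<close>
lemma transform_dipole_test_lower_bound:
  fixes a :: "nat \<Rightarrow> complex"
  assumes "1 \<le> k" "a 0 \<noteq> 0"
    and summ: "\<And>x y. x > 0 \<Longrightarrow> y > 0 \<Longrightarrow>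
           summable (\<lambda>m. a m * complex_of_real ((x * y) ^ (k * m)))"
    and K: "K = kernel a k b1 c1"
    and G: "\<And>x y. x > 0 \<Longrightarrow> y > 0 \<Longrightarrow>
           (G y has_vector_derivative complex_of_real (x powr \<nu>) * K x y) (at x)"
    and "b - b1 - \<nu> < 1"
    and bound: "\<And>x y. x > 0 \<Longrightarrow> y > 0 \<Longrightarrow> x * y \<ge> 1 \<Longrightarrow> cmod (G y x) \<le> M * x powr b * y powr c"
    and "0 < \<alpha>" "\<alpha> \<le> \<beta>"
  shows "\<exists>\<delta>>0. \<forall>\<^sub>F L in at_top. \<forall>y\<in>{\<alpha>..\<beta>}.
      \<delta> \<le> cmod (transform b0 c0 K (dipole_test (b0 + b1) L) y)"
proof -
  define E where "E z = (\<Sum>m. a m * z ^ m)" for z :: complex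
  have E0: "E 0 = a 0"
    unfolding E_def using powser_sums_zero[of a] by (simp add: sums_iff)
  have contE: "continuous_on A E" for A
    using continuous_on_power_series_of_kernel[OF \<open>1 \<le> k\<close> summ]
    unfolding E_def by (rule continuous_on_subset) auto
  have K_eq: "K x y = complex_of_real (x powr b1 * y powr c1) * E (complex_of_real ((x * y) ^ k))" for x y
    unfolding K kernel_eq_power_series E_def by simp
  have contK: "continuous_on {0<..} (\<lambda>x. K x y)" for y
    unfolding K_eq
    by (intro continuous_intros continuous_on_compose2[OF contE[of UNIV]]) auto
  define r where "r = cmod (a 0)"
  have r: "r > 0" using \<open>a 0 \<noteq> 0\<close> by (simp add: r_def)

  obtain d where d: "d > 0" "\<And>z. cmod z < d \<Longrightarrow> cmod (E z - a 0) \<le> r / 4"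
  proof -
    have "isCont E 0" using contE[of UNIV] by (simp add: continuous_on_eq_continuous_at)
    then obtain d where "d > 0" "\<And>z. dist z 0 < d \<Longrightarrow> dist (E z) (E 0) < r / 4"
      using r unfolding continuous_at_eps_delta by (metis divide_pos_pos zero_less_numeral)
    then show ?thesis using that[of d] by (force simp: dist_norm E0)
  qed

  \<comment> \<open>The exponent for which \<open>x powr e * (x powr \<nu> * K x y)\<close> is the integrand \<open>x powr (- 1 - b1) * K x y\<close>;
    then \<open>\<theta> = 1 + b1 + \<nu> - b\<close> is the rate of decay on the right plateau.\<close>
  define e where "e = - 1 - b1 - \<nu>"
  define \<theta> where "\<theta> = - (b + e)"
  have \<theta>: "\<theta> > 0" using \<open>b - b1 - \<nu> < 1\<close> by (simp add: \<theta>_def e_def)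
  obtain m1 where m1: "\<And>y. y \<in> {\<alpha>..\<beta>} \<Longrightarrow> y powr (c - c1) \<le> m1"
  proof -
    have "continuous_on {\<alpha>..\<beta>} (\<lambda>y. y powr (c - c1))"
      using \<open>0 < \<alpha>\<close> by (intro continuous_intros) auto
    then have "\<exists>z\<in>{\<alpha>..\<beta>}. \<forall>y\<in>{\<alpha>..\<beta>}. y powr (c - c1) \<le> z powr (c - c1)"
      using \<open>\<alpha> \<le> \<beta>\<close> by (intro continuous_attains_sup) auto
    then show ?thesis using that by blast
  qed
  obtain m0 where m0: "m0 > 0" "\<And>y. y \<in> {\<alpha>..\<beta>} \<Longrightarrow> m0 \<le> y powr (c0 + c1)"
  proof -
    have "continuous_on {\<alpha>..\<beta>} (\<lambda>y. y powr (c0 + c1))"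
      using \<open>0 < \<alpha>\<close> by (intro continuous_intros) auto
    then have "\<exists>z\<in>{\<alpha>..\<beta>}. \<forall>y\<in>{\<alpha>..\<beta>}. z powr (c0 + c1) \<le> y powr (c0 + c1)"
      using \<open>\<alpha> \<le> \<beta>\<close> by (intro continuous_attains_inf) auto
    then obtain z where "z \<in> {\<alpha>..\<beta>}" "\<And>y. y \<in> {\<alpha>..\<beta>} \<Longrightarrow> z powr (c0 + c1) \<le> y powr (c0 + c1)"
      by blast
    then show ?thesis
      using that[of "z powr (c0 + c1)"] \<open>0 < \<alpha>\<close> by auto
  qed
  define D where "D = \<bar>M\<bar> * (2 + \<bar>e\<bar> / \<theta>)"
  have D: "D \<ge> 0" using \<theta> by (simp add: D_def)

  \<comment> \<open>The three conditions on \<open>L\<close>: the argument of the power series is small on the left plateau; the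
    right plateau lies in the range \<open>x * y \<ge> 1\<close> where \<open>G\<close> is controlled; its contribution is small.\<close>
  have "((\<lambda>L. exp (- L) * \<beta>) \<longlongrightarrow> 0) at_top"
    by (intro tendsto_mult_left_zero filterlim_compose[OF exp_at_bot filterlim_uminus_at_bot_at_top])
  then have ev1: "\<forall>\<^sub>F L in at_top. exp (- L) * \<beta> < min d 1"
    using d(1) by (intro order_tendstoD) auto
  have ev2: "\<forall>\<^sub>F L in at_top. 1 / \<alpha> \<le> exp L"
    using exp_at_top by (rule filterlim_at_top[THEN iffD1, rule_format])
  have "((\<lambda>L. D * m1 * exp L powr (- \<theta>)) \<longlongrightarrow> 0) at_top"
    using \<theta> by (intro tendsto_mult_right_zero tendsto_neg_powr exp_at_top) simp
  then have ev3: "\<forall>\<^sub>F L in at_top. D * m1 * exp L powr (- \<theta>) < r / 4"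
    using r by (intro order_tendstoD) auto

  have "\<forall>\<^sub>F L in at_top. \<forall>y\<in>{\<alpha>..\<beta>}.
      m0 * (r / 2) \<le> cmod (transform b0 c0 K (dipole_test (b0 + b1) L) y)"
    using ev1 ev2 ev3 eventually_ge_at_top[of 1]
  proof eventually_elim
    case (elim L)
    show ?case
    proof
      fix y assume y: "y \<in> {\<alpha>..\<beta>}"
      with \<open>0 < \<alpha>\<close> have "y > 0" by auto
      let ?\<phi> = "\<lambda>x. complex_of_real (x powr (- 1 - b1)) * K x y"
      let ?I = "{exp (- 2 * L)..exp (- L)}" and ?J = "{exp L..exp (2 * L)}"
      define P Q where "P = integral ?I ?\<phi>" and "Q = integral ?J ?\<phi>"

      have inv: "((\<lambda>x. 1 / x) has_integral L) ?I"
        using has_integral_inverse_exp[of "- 2 * L" "- L"] elim(4) by simp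
      have "(?\<phi> has_integral P) ?I"
        unfolding P_def
      proof (intro integrable_integral integrable_continuous_interval)
        have "continuous_on {0<..} ?\<phi>"
          by (intro continuous_intros contK) auto
        then show "continuous_on ?I ?\<phi>"
          by (rule continuous_on_subset) (auto intro: less_le_trans[OF exp_gt_zero])
      qed
      from has_integral_diff[OF this
          has_integral_mult_right[OF has_integral_of_real[OF inv], of "a 0 * complex_of_real (y powr c1)"]]
      have P': "((\<lambda>x. ?\<phi> x - a 0 * complex_of_real (y powr c1) * complex_of_real (1 / x))
          has_integral P - a 0 * complex_of_real (y powr c1) * complex_of_real L) ?I" .
      have inv': "((\<lambda>x. y powr c1 * (r / 4) * (1 / x)) has_integral y powr c1 * (r / 4) * L) ?I"
        by (rule has_integral_mult_right[OF inv])
      have "cmod (integral ?I (\<lambda>x. ?\<phi> x - a 0 * complex_of_real (y powr c1) * complex_of_real (1 / x)))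
          \<le> integral ?I (\<lambda>x. y powr c1 * (r / 4) * (1 / x))"
      proof (rule integral_norm_bound_integral[OF has_integral_integrable[OF P'] has_integral_integrable[OF inv']])
        fix x assume x: "x \<in> ?I"
        have "x > 0" using x less_le_trans[OF exp_gt_zero] by auto
        have "x * y \<le> exp (- L) * \<beta>"
          using x y \<open>x > 0\<close> \<open>y > 0\<close> by (intro mult_mono) auto
        then have xy: "x * y < d" "x * y \<le> 1"
          using elim(1) by auto
        \<comment> \<open>Since \<open>x * y \<le> 1\<close> and \<open>k \<ge> 1\<close>, smallness of \<open>x * y\<close> is inherited by its \<open>k\<close>-th power.\<close>
        have "(x * y) ^ k \<le> (x * y) ^ 1"
          using xy \<open>x > 0\<close> \<open>y > 0\<close> \<open>1 \<le> k\<close> by (intro power_decreasing) auto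
        then have "cmod (complex_of_real ((x * y) ^ k)) < d"
          using xy \<open>x > 0\<close> \<open>y > 0\<close> by (simp add: norm_mult norm_power)
        note close = d(2)[OF this]
        have "?\<phi> x - a 0 * complex_of_real (y powr c1) * complex_of_real (1 / x)
            = complex_of_real (y powr c1 * (1 / x)) * (E (complex_of_real ((x * y) ^ k)) - a 0)"
          using \<open>x > 0\<close> by (simp add: K_eq powr_diff powr_minus field_simps)
        also have "cmod \<dots> \<le> y powr c1 * (1 / x) * (r / 4)"
          unfolding norm_mult norm_of_real using close \<open>x > 0\<close> by (intro mult_mono) auto
        finally show "cmod (?\<phi> x - a 0 * complex_of_real (y powr c1) * complex_of_real (1 / x))
            \<le> y powr c1 * (r / 4) * (1 / x)"
          by (simp add: mult_ac)
      qed
      then have "cmod (P - a 0 * complex_of_real (y powr c1) * complex_of_real L)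
          \<le> y powr c1 * (r / 4) * L"
        by (simp only: integral_unique[OF P'] integral_unique[OF inv'])
      moreover have "cmod (a 0 * complex_of_real (y powr c1) * complex_of_real L) = r * (y powr c1) * L"
        using elim(4) by (simp add: norm_mult r_def)
      ultimately have P: "cmod P \<ge> 3 / 4 * r * (y powr c1) * L"
        using norm_triangle_ineq2[of "a 0 * complex_of_real (y powr c1) * complex_of_real L" P]
        by (simp add: norm_minus_commute algebra_simps)

      have "Q = integral ?J (\<lambda>x. complex_of_real (x powr e) * (complex_of_real (x powr \<nu>) * K x y))"
        unfolding Q_def
      proof (rule integral_cong)
        fix x assume "x \<in> ?J"
        then have "x > 0" using less_le_trans[OF exp_gt_zero] by auto
        then have "x powr (- 1 - b1) = x powr e * x powr \<nu>"
          by (simp add: e_def flip: powr_add)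
        then show "?\<phi> x = complex_of_real (x powr e) * (complex_of_real (x powr \<nu>) * K x y)"
          by simp
      qed
      \<comment> \<open>The absolute value allows an arbitrary constant \<open>M\<close> when the factors are enlarged to \<open>D * m1\<close>.\<close>
      also have "cmod \<dots> \<le> (\<bar>M\<bar> * y powr c) * (2 + \<bar>e\<bar> / - (b + e)) * exp L powr (b + e)"
      proof (rule norm_integral_le_of_primitive)
        fix x assume x: "x \<in> ?J"
        then have "x > 0" using less_le_trans[OF exp_gt_zero] by auto
        then show "(G y has_vector_derivative complex_of_real (x powr \<nu>) * K x y) (at x)"
          using \<open>y > 0\<close> by (rule G)
        have "1 / \<alpha> * \<alpha> \<le> x * y"
          using x y elim(2) \<open>0 < \<alpha>\<close> \<open>x > 0\<close> by (intro mult_mono) auto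
        then have "cmod (G y x) \<le> M * x powr b * y powr c"
          using bound \<open>x > 0\<close> \<open>y > 0\<close> \<open>0 < \<alpha>\<close> by simp
        also have "\<dots> \<le> \<bar>M\<bar> * x powr b * y powr c"
          by (intro mult_right_mono) auto
        finally show "cmod (G y x) \<le> \<bar>M\<bar> * y powr c * x powr b"
          by (simp add: mult_ac)
      qed (use elim(4) \<theta> in \<open>auto simp: \<theta>_def\<close>)
      also have "\<dots> = y powr c1 * (D * y powr (c - c1) * exp L powr (- \<theta>))"
        using \<open>y > 0\<close> by (simp add: D_def \<theta>_def powr_diff add.commute)
      also have "\<dots> \<le> y powr c1 * (D * m1 * exp L powr (- \<theta>))"
        using m1[OF y] D by (intro mult_left_mono mult_right_mono) auto
      also have "\<dots> \<le> y powr c1 * (r / 4)"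
        using elim(3) by (intro mult_left_mono) auto
      also have "\<dots> \<le> y powr c1 * (r / 4) * L"
        using mult_left_mono[of 1 L "y powr c1 * (r / 4)"] elim(4) r by simp
      finally have "cmod (P - Q) \<ge> r / 2 * y powr c1 * L"
        using P norm_triangle_ineq2[of P Q] by (simp add: algebra_simps)
      then have "cmod ((P - Q) /\<^sub>R L) \<ge> r / 2 * y powr c1"
        using elim(4) by (simp add: pos_le_divide_eq flip: divide_inverse_commute)
      then have "y powr c0 * cmod ((P - Q) /\<^sub>R L) \<ge> y powr c0 * (r / 2 * y powr c1)"
        by (intro mult_left_mono) auto
      moreover have "cmod (transform b0 c0 K (dipole_test (b0 + b1) L) y)
          = y powr c0 * cmod ((P - Q) /\<^sub>R L)"
        unfolding transform_dipole_test[OF \<open>y > 0\<close> contK] P_def Q_def by (simp add: norm_mult)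
      moreover have "m0 * (r / 2) \<le> y powr c0 * (r / 2 * y powr c1)"
        using mult_right_mono[OF m0(2)[OF y], of "r / 2"] r \<open>y > 0\<close>
        by (simp add: powr_add mult_ac)
      ultimately show "m0 * (r / 2) \<le> cmod (transform b0 c0 K (dipole_test (b0 + b1) L) y)"
        by linarith
    qed
  qed
  moreover have "m0 * (r / 2) > 0" using m0 r by simp
  ultimately show ?thesis by blast
qed

section \<open>Failure of the weighted inequality\<close>

theorem proposition5p7:
  fixes q :: ennreal and p b0 b1 b2 c0 c1 c2 \<nu> b c :: real
    and k :: nat and a :: "nat \<Rightarrow> complex"
    and K G :: "real \<Rightarrow> real \<Rightarrow> complex" and u :: "real \<Rightarrow> real"
  assumes "0 < q" and "1 < p" and "1 \<le> k"
    and "cmod (a 0) > 0" and "summable (\<lambda>m. cmod (a m))"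
    and "\<And>x y. x > 0 \<Longrightarrow> y > 0 \<Longrightarrow>
           summable (\<lambda>m. a m * complex_of_real ((x * y) ^ (k * m)))"
    and K_def: "K = kernel a k b1 c1"
    and "\<exists>C>0. \<forall>x>0. \<forall>y>0.
           (x * y \<le> 1 \<longrightarrow> cmod (K x y) \<le> C * x powr b1 * y powr c1) \<and>
           (x * y > 1 \<longrightarrow> cmod (K x y) \<le> C * x powr b2 * y powr c2)"
    and "\<And>x y. x > 0 \<Longrightarrow> y > 0 \<Longrightarrow>
           (G y has_vector_derivative complex_of_real (x powr \<nu>) * K x y) (at x)"
    and "b - b1 - \<nu> < 1"
    and "\<exists>C'>0. \<forall>x>0. \<forall>y>0. x * y \<ge> 1 \<longrightarrow> cmod (G y x) \<le> C' * x powr b * y powr c"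
    and "weight u" and "\<not> (AE y in pos_lebesgue. u y = 0)"
  shows "\<not> (\<exists>A::real. A > 0 \<and>
           (\<forall>f. admissible b0 b1 b2 f \<and>
                (LINT x|pos_lebesgue. complex_of_real (x powr (b0 + b1)) * f x) = 0 \<longrightarrow>
                weighted_norm q u (transform b0 c0 K f)
                \<le> ennreal A * weighted_norm (ennreal p)
                    (\<lambda>x. x powr (p * (1 / conj_exp p + b0 + b1))) f))"
proof
  assume "\<exists>A::real. A > 0 \<and>
           (\<forall>f. admissible b0 b1 b2 f \<and>
                (LINT x|pos_lebesgue. complex_of_real (x powr (b0 + b1)) * f x) = 0 \<longrightarrow>
                weighted_norm q u (transform b0 c0 K f)
                \<le> ennreal A * weighted_norm (ennreal p)
                    (\<lambda>x. x powr (p * (1 / conj_exp p + b0 + b1))) f)"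
  then obtain A where "A > 0" and A: "\<And>f. admissible b0 b1 b2 f \<Longrightarrow>
      (LINT x|pos_lebesgue. complex_of_real (x powr (b0 + b1)) * f x) = 0 \<Longrightarrow>
      weighted_norm q u (transform b0 c0 K f)
        \<le> ennreal A * weighted_norm (ennreal p) (\<lambda>x. x powr (p * (1 / conj_exp p + b0 + b1))) f"
    by blast
  obtain M where M: "\<And>x y. x > 0 \<Longrightarrow> y > 0 \<Longrightarrow> x * y \<ge> 1 \<Longrightarrow> cmod (G y x) \<le> M * x powr b * y powr c"
    using assms(11) by blast
  let ?Tf = "\<lambda>L. transform b0 c0 K (dipole_test (b0 + b1) L)"
  define \<rho> where "\<rho> L = A * (2 * L powr (1 - p)) powr (1 / p)" for L
  have norm_le: "weighted_norm q u (?Tf L) \<le> ennreal (\<rho> L)" if "L > 0" for L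
    using A[OF admissible_dipole_test integral_dipole_test[OF that]] \<open>A > 0\<close> \<open>1 < p\<close>
    by (simp add: weighted_norm_dipole_test that \<rho>_def ennreal_mult)
  have "((\<lambda>L. 2 * L powr (1 - p)) \<longlongrightarrow> 0) at_top"
    using \<open>1 < p\<close>
    by (intro tendsto_mult_right_zero tendsto_neg_powr filterlim_ident) auto
  then have "((\<lambda>L. (2 * L powr (1 - p)) powr (1 / p)) \<longlongrightarrow> 0) at_top"
    using \<open>1 < p\<close> by (intro tendsto_zero_powrI) auto
  then have "(\<rho> \<longlongrightarrow> 0) at_top"
    unfolding \<rho>_def by (rule tendsto_mult_right_zero)
  \<comment> \<open>The intervals exhaust the half-line, and on each of them the weight is measurable, as it is
    integrable there.\<close>
  have null: "AE y in lebesgue_on {1 / Suc n..Suc n}. u y = 0" for n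
  proof -
    let ?S = "{1 / Suc n..real (Suc n)}"
    have sub: "?S \<subseteq> {0<..}"
      by (auto simp del: of_nat_Suc intro: less_le_trans[of 0 "1 / real (Suc n)"])
    have "1 / Suc n \<le> real (Suc n)" by (simp add: field_simps)
    then obtain \<delta> where \<delta>: "\<delta> > 0" "\<forall>\<^sub>F L in at_top. \<forall>y\<in>?S. \<delta> \<le> cmod (?Tf L y)"
      using transform_dipole_test_lower_bound[OF \<open>1 \<le> k\<close> _ assms(6) K_def assms(9)
          \<open>b - b1 - \<nu> < 1\<close> M, of "1 / Suc n" "Suc n"] assms(4) by auto
    show ?thesis
    proof (rule weight_zero_AE_of_small_norm[OF \<open>0 < q\<close> _ sub _ _ \<open>\<delta> > 0\<close>])
      have "integrable (lebesgue_on ?S) u"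
        using \<open>weight u\<close> sub by (auto simp: weight_def)
      then show "u \<in> borel_measurable (lebesgue_on ?S)" by simp
      show "0 \<le> u y" if "y \<in> ?S" for y
        using \<open>weight u\<close> sub that by (auto simp: weight_def)
      fix \<epsilon> :: real assume "\<epsilon> > 0"
      then have "\<forall>\<^sub>F L in at_top. \<rho> L < \<epsilon>"
        using \<open>(\<rho> \<longlongrightarrow> 0) at_top\<close> by (rule order_tendstoD[rotated])
      then have "\<forall>\<^sub>F L in at_top. \<rho> L < \<epsilon> \<and> (\<forall>y\<in>?S. \<delta> \<le> cmod (?Tf L y)) \<and> L > 0"
        using \<delta>(2) eventually_gt_at_top[of 0] by eventually_elim blast
      then obtain L where "\<rho> L < \<epsilon>" "\<forall>y\<in>?S. \<delta> \<le> cmod (?Tf L y)" "L > 0"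
        using eventually_happens by force
      then show "\<exists>g. weighted_norm q u g \<le> ennreal \<epsilon> \<and> (\<forall>y\<in>?S. \<delta> \<le> cmod (g y))"
        using norm_le[OF \<open>L > 0\<close>] \<open>\<rho> L < \<epsilon>\<close>
        by (intro exI[of _ "?Tf L"] conjI order_trans[OF norm_le ennreal_leI]) auto
    qed simp
  qed
  have "AE y in lebesgue. \<forall>n. y \<in> {1 / Suc n..Suc n} \<longrightarrow> u y = 0"
    unfolding AE_all_countable using null by (simp add: AE_restrict_space_iff)
  then have "AE y in pos_lebesgue. u y = 0"
    unfolding AE_restrict_space_iff[of "{0<..} :: real set" lebesgue, simplified]
  proof eventually_elim
    case (elim y)
    show ?case
    proof
      assume "0 < y"
      obtain n where n: "max y (1 / y) \<le> real n" using real_arch_simple by blast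
      then have "y \<le> Suc n" "1 / y \<le> Suc n" by auto
      then have "y \<in> {1 / Suc n..Suc n}"
        using \<open>0 < y\<close> by (auto simp: field_simps)
      with elim show "u y = 0" by blast
    qed
  qed
  with assms(13) show False by contradiction
qed

end
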